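(* The formula $$R(\varphi)=\prod_{i=0}^{k-1}|A_i:[e]_{\varphi_i}|$$ does not hold for finite nilpotent groups in general; that is, there exist a finite nilpotent group $G$, of nilpotency class $k$, and an automorphism $\varphi$ of $G$ such that $R(\varphi)\neq\prod_{i=0}^{k-1}|A_i:[e]_{\varphi_i}|$.
   Context: For an automorphism $\varphi$ of a group $G$, elements $x,y\in G$ are $\varphi$-conjugated if $y=z^{-1}xz^{\varphi}$ for some $z\in G$, where $z^\varphi$ is the image of $z$ under $\varphi$; $[x]_{\varphi}$ denotes the class of $x$, and $R(\varphi)$ is the number of $\varphi$-conjugacy classes. For $G$ nilpotent of class $k$, let $1=\zeta_0G<\zeta_1G<\dots<\zeta_kG=G$ be its upper central series, $A_i=\zeta_{i+1}G/\zeta_iG$, and let $\varphi_i$ be the automorphism of $A_i$ induced by $\varphi$. The class $[e]_{\varphi_i}$ of the unit element of $A_i$ is a subgroup of $A_i$ because $A_i$ is abelian. *)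

theory Defs
  imports "HOL-Algebra.Algebra"
begin

section \<open>Twisted conjugacy\<close>

definition twisted_conj :: "('a, 'b) monoid_scheme \<Rightarrow> ('a \<Rightarrow> 'a) \<Rightarrow> 'a \<Rightarrow> 'a \<Rightarrow> bool" where
  "twisted_conj G \<phi> x y \<longleftrightarrow>
     (\<exists>z\<in>carrier G. y = inv\<^bsub>G\<^esub> z \<otimes>\<^bsub>G\<^esub> x \<otimes>\<^bsub>G\<^esub> \<phi> z)"

definition twisted_class :: "('a, 'b) monoid_scheme \<Rightarrow> ('a \<Rightarrow> 'a) \<Rightarrow> 'a \<Rightarrow> 'a set" where
  "twisted_class G \<phi> x = {y \<in> carrier G. twisted_conj G \<phi> x y}"

text \<open>The Reidemeister number. It takes the value \<open>0\<close> if there are infinitely many classes, so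
  it is meaningful only when there are finitely many, e.g. for finite \<open>G\<close>.\<close>

definition reidemeister_number :: "('a, 'b) monoid_scheme \<Rightarrow> ('a \<Rightarrow> 'a) \<Rightarrow> nat" where
  "reidemeister_number G \<phi> = card (twisted_class G \<phi> ` carrier G)"


section \<open>Upper central series\<close>

definition group_center :: "('a, 'b) monoid_scheme \<Rightarrow> 'a set" where
  "group_center G = {z \<in> carrier G. \<forall>g\<in>carrier G. z \<otimes>\<^bsub>G\<^esub> g = g \<otimes>\<^bsub>G\<^esub> z}"

text \<open>The term with index \<open>i + 1\<close> is the full preimage in \<open>G\<close> of the center of \<open>G Mod \<zeta>\<^sub>i G\<close>.\<close>

primrec upper_central :: "('a, 'b) monoid_scheme \<Rightarrow> nat \<Rightarrow> 'a set" where
  "upper_central G 0 = {\<one>\<^bsub>G\<^esub>}"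
| "upper_central G (Suc i) =
     {x \<in> carrier G. upper_central G i #>\<^bsub>G\<^esub> x \<in> group_center (G Mod upper_central G i)}"

definition nilpotent_of_class :: "('a, 'b) monoid_scheme \<Rightarrow> nat \<Rightarrow> bool" where
  "nilpotent_of_class G k \<longleftrightarrow>
     group G \<and> (\<forall>i<k. upper_central G i \<subset> upper_central G (Suc i)) \<and>
     upper_central G k = carrier G"

definition upper_central_factor :: "('a, 'b) monoid_scheme \<Rightarrow> nat \<Rightarrow> 'a set monoid" where
  "upper_central_factor G i = (G\<lparr>carrier := upper_central G (Suc i)\<rparr>) Mod upper_central G i"

text \<open>Elements of a factor group are cosets, and an automorphism \<open>\<phi>\<close> of \<open>G\<close> preserves each
  term \<open>N\<close> of the series, so \<open>\<phi> ` (N x) = N (\<phi> x)\<close>: the map induced by \<open>\<phi>\<close> on every factor is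
  the image map.\<close>

definition induced_map :: "('a \<Rightarrow> 'a) \<Rightarrow> 'a set \<Rightarrow> 'a set" where
  "induced_map \<phi> C = \<phi> ` C"

definition subgroup_index :: "('a, 'b) monoid_scheme \<Rightarrow> 'a set \<Rightarrow> nat" where
  "subgroup_index G H = card (rcosets\<^bsub>G\<^esub> H)"

end

theory Submission
  imports Defs
begin

text \<open>
  Already the identity automorphism of a finite non-abelian nilpotent group \<open>G\<close> refutes the
  formula, because the two sides then measure different things.

  For \<open>\<phi> = id\<close>, twisted conjugacy is ordinary conjugacy, so \<open>R(id)\<close> is the number of
  conjugacy classes. Two distinct conjugate elements exist as soon as \<open>G\<close> is not abelian, so that
  \<open>R(id) < |G|\<close> (\<open>reidemeister_number_id_less_order\<close>). On the other side, a factor \<open>A\<^sub>i\<close> of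
  the upper central series is a group on which the identity is induced, so the twisted class of
  its unit is \<open>{z\<inverse> z} = {e}\<close>, and the index is \<open>|A\<^sub>i| = |\<zeta>\<^sub>i\<^sub>+\<^sub>1 G| / |\<zeta>\<^sub>i G|\<close>. The product
  telescopes to \<open>|G|\<close> (\<open>prod_subgroup_index_id\<close>).

  It remains to exhibit one non-abelian nilpotent group; the dihedral group of order 8 will do.
  It has class 2 and five conjugacy classes, so the formula would read \<open>5 = 2 \<cdot> 4\<close>.
\<close>

section \<open>The upper central series\<close>

lemma group_center_subgroup:
  fixes G (structure)
  assumes "group G"
  shows "subgroup (group_center G) G"
proof -
  interpret group G by fact
  show ?thesis
  proof (rule subgroupI)
    show "group_center G \<subseteq> carrier G" "group_center G \<noteq> {}"
      by (auto simp: group_center_def)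
  next
    fix a assume a: "a \<in> group_center G"
    then have ac: "a \<in> carrier G" by (simp add: group_center_def)
    have "inv a \<otimes> g = g \<otimes> inv a" if g: "g \<in> carrier G" for g
    proof -
      have "a \<otimes> inv g = inv g \<otimes> a" using a g by (simp add: group_center_def)
      then have "inv (a \<otimes> inv g) = inv (inv g \<otimes> a)" by simp
      then show ?thesis using ac g by (simp add: inv_mult_group)
    qed
    then show "inv a \<in> group_center G" using ac by (simp add: group_center_def)
  next
    fix a b assume "a \<in> group_center G" "b \<in> group_center G"
    then have ac: "a \<in> carrier G" and bc: "b \<in> carrier G"
      and ca: "\<And>g. g \<in> carrier G \<Longrightarrow> a \<otimes> g = g \<otimes> a"
      and cb: "\<And>g. g \<in> carrier G \<Longrightarrow> b \<otimes> g = g \<otimes> b"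
      by (auto simp: group_center_def)
    have "a \<otimes> b \<otimes> g = g \<otimes> (a \<otimes> b)" if g: "g \<in> carrier G" for g
    proof -
      have "a \<otimes> b \<otimes> g = a \<otimes> (g \<otimes> b)" using ac bc g cb by (simp add: m_assoc)
      also have "\<dots> = g \<otimes> a \<otimes> b" using ac bc g ca by (simp flip: m_assoc)
      finally show ?thesis using ac bc g by (simp add: m_assoc)
    qed
    then show "a \<otimes> b \<in> group_center G" using ac bc by (simp add: group_center_def)
  qed
qed

text \<open>The step of the upper central series preserves normality: the preimage of the center is a
  subgroup because the projection is a homomorphism, and it is normal because conjugation does
  not move central cosets.\<close>

lemma normal_center_preimage:
  fixes G (structure)
  assumes "N \<lhd> G"
  shows "{x \<in> carrier G. N #>\<^bsub>G\<^esub> x \<in> group_center (G Mod N)} \<lhd> G" (is "?M \<lhd> G")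
proof -
  interpret normal N G by fact
  interpret Q: group "G Mod N" by (rule factorgroup_is_group)
  interpret c: group_hom G "G Mod N" "\<lambda>x. N #> x"
    by unfold_locales (rule r_coset_hom_Mod)
  interpret Z: subgroup "group_center (G Mod N)" "G Mod N"
    by (rule group_center_subgroup[OF Q.group_axioms])
  have sub: "subgroup ?M G"
  proof (rule subgroupI)
    have "\<one> \<in> ?M" using Z.one_closed c.hom_one by simp
    then show "?M \<noteq> {}" by blast
  next
    fix a assume "a \<in> ?M"
    then show "inv a \<in> ?M" using Z.m_inv_closed c.hom_inv by auto
  next
    fix a b assume "a \<in> ?M" "b \<in> ?M"
    then show "a \<otimes> b \<in> ?M" using Z.m_closed c.hom_mult[of a b] by auto
  qed auto
  have "g \<otimes> x \<otimes> inv g \<in> ?M" if g: "g \<in> carrier G" and x: "x \<in> ?M" for g x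
  proof -
    have xc: "x \<in> carrier G" using x by simp
    have "(N #> x) <#> (N #> g) = (N #> g) <#> (N #> x)"
      using x c.hom_closed[OF g] unfolding group_center_def by simp
    then have "N #> (x \<otimes> g) = N #> (g \<otimes> x)"
      using rcos_sum[OF xc g] rcos_sum[OF g xc] by simp
    then have "N #> (g \<otimes> x \<otimes> inv g) = N #> (x \<otimes> g \<otimes> inv g)"
      using g xc rcos_sum[of "g \<otimes> x" "inv g"] rcos_sum[of "x \<otimes> g" "inv g"] by simp
    also have "\<dots> = N #> x" using g xc by (simp add: m_assoc)
    finally show ?thesis using x g by simp
  qed
  with sub show ?thesis by (simp add: normal_inv_iff)
qed

lemma upper_central_normal:
  fixes G (structure)
  assumes "group G"
  shows "upper_central G i \<lhd> G"
proof (induction i)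
  case 0
  show ?case using group.one_is_normal[OF assms] by simp
next
  case (Suc i)
  then show ?case using normal_center_preimage by simp
qed

lemma upper_central_mono_Suc:
  fixes G (structure)
  assumes "group G"
  shows "upper_central G i \<subseteq> upper_central G (Suc i)"
proof
  interpret normal "upper_central G i" G by (rule upper_central_normal[OF assms])
  interpret Z: subgroup "group_center (G Mod upper_central G i)" "G Mod upper_central G i"
    by (rule group_center_subgroup[OF factorgroup_is_group])
  fix x assume x: "x \<in> upper_central G i"
  have "upper_central G i #> x = upper_central G i"
    by (rule coset_join2[OF mem_carrier[OF x] subgroup_axioms x])
  then show "x \<in> upper_central G (Suc i)" using x Z.one_closed mem_carrier[OF x] by simp
qed

text \<open>An elementwise description of the step, free of quotients, which can be checked by
  computation in a concrete group.\<close>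

lemma upper_central_Suc_iff:
  fixes G (structure)
  assumes "group G"
  shows "x \<in> upper_central G (Suc i) \<longleftrightarrow> x \<in> carrier G \<and>
    (\<forall>g\<in>carrier G. \<exists>n\<in>upper_central G i. x \<otimes>\<^bsub>G\<^esub> g = n \<otimes>\<^bsub>G\<^esub> (g \<otimes>\<^bsub>G\<^esub> x))"
proof (cases "x \<in> carrier G")
  case True
  let ?N = "upper_central G i"
  interpret normal ?N G by (rule upper_central_normal[OF assms])
  have eq: "?N #> a = ?N #> b \<longleftrightarrow> a \<in> ?N #> b" if "a \<in> carrier G" "b \<in> carrier G" for a b
    using that repr_independence repr_independenceD subgroup_axioms by metis
  have "x \<in> upper_central G (Suc i) \<longleftrightarrow>
    (\<forall>g\<in>carrier G. ?N #> (x \<otimes> g) = ?N #> (g \<otimes> x))"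
    using True by (auto simp: group_center_def carrier_FactGroup rcos_sum)
  also have "\<dots> \<longleftrightarrow> (\<forall>g\<in>carrier G. x \<otimes> g \<in> ?N #> (g \<otimes> x))"
    using True by (simp add: eq)
  finally show ?thesis using True by (simp add: r_coset_def)
qed simp

section \<open>Both sides of the formula for the identity automorphism\<close>

text \<open>Two distinct conjugate elements have the same class, so the map from elements to classes is
  not injective.\<close>

lemma reidemeister_number_id_less_order:
  fixes G (structure)
  assumes "group G" "finite (carrier G)"
    and x: "x \<in> carrier G" and y: "y \<in> carrier G" and ne: "x \<otimes>\<^bsub>G\<^esub> y \<noteq> y \<otimes>\<^bsub>G\<^esub> x"
  shows "reidemeister_number G id < order G"
proof -
  interpret group G by fact
  let ?C = "twisted_class G id"
  define x' where "x' = inv y \<otimes> x \<otimes> y"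
  have x': "x' \<in> carrier G" using x y by (simp add: x'_def)
  have yx': "y \<otimes> x' = x \<otimes> y" using x y by (simp add: x'_def m_assoc[symmetric])
  then have "x' \<noteq> x" using ne by metis
  have conj: "u \<in> ?C v \<longleftrightarrow> u \<in> carrier G \<and> (\<exists>z\<in>carrier G. z \<otimes> u = v \<otimes> z)"
    if "v \<in> carrier G" for u v
  proof -
    have "u = inv z \<otimes> v \<otimes> z \<longleftrightarrow> z \<otimes> u = v \<otimes> z" if "u \<in> carrier G" "z \<in> carrier G" for z
      using inv_solve_left[of u z "v \<otimes> z"] that \<open>v \<in> carrier G\<close> by (auto simp: m_assoc)
    then show ?thesis by (auto simp: twisted_class_def twisted_conj_def)
  qed
  have "?C x' = ?C x"
  proof (intro Set.set_eqI iffI)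
    fix u assume "u \<in> ?C x'"
    then obtain z where u: "u \<in> carrier G" and z: "z \<in> carrier G" "z \<otimes> u = x' \<otimes> z"
      using conj[OF x'] by auto
    have "y \<otimes> z \<otimes> u = y \<otimes> x' \<otimes> z" using u z x' y by (simp add: m_assoc)
    also have "\<dots> = x \<otimes> (y \<otimes> z)" using x y z yx' by (simp add: m_assoc)
    finally show "u \<in> ?C x" using conj[OF x] u y z(1) by blast
  next
    fix u assume "u \<in> ?C x"
    then obtain z where u: "u \<in> carrier G" and z: "z \<in> carrier G" "z \<otimes> u = x \<otimes> z"
      using conj[OF x] by auto
    have "inv y \<otimes> z \<otimes> u = inv y \<otimes> x \<otimes> z" using u z x y by (simp add: m_assoc)
    also have "\<dots> = x' \<otimes> (inv y \<otimes> z)"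
      using x y z by (simp add: x'_def m_assoc) (simp add: m_assoc[symmetric])
    finally show "u \<in> ?C x'" using conj[OF x'] u y z(1) by blast
  qed
  then have "\<not> inj_on ?C (carrier G)" using x x' \<open>x' \<noteq> x\<close> by (auto dest: inj_onD)
  then have "card (?C ` carrier G) \<noteq> card (carrier G)"
    using assms(2) by (blast dest: eq_card_imp_inj_on)
  moreover have "card (?C ` carrier G) \<le> card (carrier G)"
    using assms(2) by (rule card_image_le)
  ultimately show ?thesis by (simp add: reidemeister_number_def order_def)
qed

lemma subgroup_index_id:
  fixes G (structure)
  assumes "group G"
  shows "subgroup_index G (twisted_class G (induced_map id) \<one>\<^bsub>G\<^esub>) = order G"
proof -
  interpret group G by fact
  have "twisted_class G (induced_map id) \<one> = {\<one>}"
    by (auto simp: twisted_class_def twisted_conj_def induced_map_def)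
  moreover have "card (rcosets {\<one>}) * card {\<one>} = order G"
    by (rule lagrange[OF triv_subgroup])
  ultimately show ?thesis by (simp add: subgroup_index_def)
qed

lemma upper_central_factor_group:
  fixes G (structure)
  assumes "group G"
  shows "group (upper_central_factor G i)"
    and "order (upper_central_factor G i) * card (upper_central G i) =
      card (upper_central G (Suc i))"
proof -
  interpret group G by fact
  let ?S = "G\<lparr>carrier := upper_central G (Suc i)\<rparr>"
  have S: "subgroup (upper_central G (Suc i)) G"
    using upper_central_normal[OF assms] by (rule normal_imp_subgroup)
  then interpret S: group ?S by (rule subgroup_imp_group)
  interpret normal "upper_central G i" ?S
    by (rule normal_restrict_supergroup[OF S upper_central_normal[OF assms]
          upper_central_mono_Suc[OF assms]])
  show "group (upper_central_factor G i)"
    unfolding upper_central_factor_def by (rule factorgroup_is_group)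
  show "order (upper_central_factor G i) * card (upper_central G i) =
      card (upper_central G (Suc i))"
    using S.lagrange[OF subgroup_axioms]
    by (simp add: upper_central_factor_def order_def FactGroup_def)
qed

text \<open>By Lagrange's theorem the orders of the factors telescope.\<close>

lemma prod_subgroup_index_id:
  assumes "nilpotent_of_class G k"
  shows "(\<Prod>i<k. subgroup_index (upper_central_factor G i)
           (twisted_class (upper_central_factor G i) (induced_map id)
              \<one>\<^bsub>upper_central_factor G i\<^esub>)) = order G"
proof -
  have G: "group G" and top: "upper_central G k = carrier G"
    using assms by (auto simp: nilpotent_of_class_def)
  have "(\<Prod>i<n. order (upper_central_factor G i)) = card (upper_central G n)" for n
  proof (induction n)
    case (Suc n)
    then show ?case
      using upper_central_factor_group(2)[OF G, of n] by (simp add: mult.commute)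
  qed simp
  then show ?thesis
    using subgroup_index_id[OF upper_central_factor_group(1)[OF G]] top
    by (simp add: order_def)
qed

section \<open>The dihedral group of order 8\<close>

text \<open>The dihedral group of order 8 in the encoding \<open>x \<cdot> y = x + (-1)\<^sup>x y\<close> on \<open>\<int>/8\<close>:
  the even residues form the cyclic subgroup of rotations, and the odd ones are the reflections.
  The associative law holds because \<open>x \<cdot> y\<close> has the parity of \<open>x + y\<close>. The summand 8 keeps the
  difference of natural numbers from being truncated.\<close>

definition dihedral8 :: "nat monoid" where
  "dihedral8 = \<lparr>carrier = {0,1,2,3,4,5,6,7},
     monoid.mult = (\<lambda>x y. if even x then (x + y) mod 8 else (x + 8 - y) mod 8), one = 0\<rparr>"

lemma dihedral8_simps:
  "carrier dihedral8 = {0,1,2,3,4,5,6,7}"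
  "x \<otimes>\<^bsub>dihedral8\<^esub> y = (if even x then (x + y) mod 8 else (x + 8 - y) mod 8)"
  "\<one>\<^bsub>dihedral8\<^esub> = 0"
  by (simp_all add: dihedral8_def)

lemma dihedral8_group: "group dihedral8"
proof (rule groupI)
  fix x y assume "x \<in> carrier dihedral8" "y \<in> carrier dihedral8"
  have "n mod 8 \<in> {0,1,2,3,4,5,6,7}" for n :: nat
    using mod_less_divisor[of 8 n] by (simp only: insert_iff empty_iff) linarith
  then show "x \<otimes>\<^bsub>dihedral8\<^esub> y \<in> carrier dihedral8" unfolding dihedral8_simps by auto
next
  fix x y z
  assume "x \<in> carrier dihedral8" "y \<in> carrier dihedral8" "z \<in> carrier dihedral8"
  moreover have "\<forall>x\<in>carrier dihedral8. \<forall>y\<in>carrier dihedral8. \<forall>z\<in>carrier dihedral8.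
    x \<otimes>\<^bsub>dihedral8\<^esub> y \<otimes>\<^bsub>dihedral8\<^esub> z = x \<otimes>\<^bsub>dihedral8\<^esub> (y \<otimes>\<^bsub>dihedral8\<^esub> z)"
    by code_simp
  ultimately show "x \<otimes>\<^bsub>dihedral8\<^esub> y \<otimes>\<^bsub>dihedral8\<^esub> z = x \<otimes>\<^bsub>dihedral8\<^esub> (y \<otimes>\<^bsub>dihedral8\<^esub> z)"
    by blast
next
  fix x assume "x \<in> carrier dihedral8"
  moreover have "\<forall>x\<in>carrier dihedral8. \<exists>y\<in>carrier dihedral8.
    y \<otimes>\<^bsub>dihedral8\<^esub> x = \<one>\<^bsub>dihedral8\<^esub>"
    by code_simp
  ultimately show "\<exists>y\<in>carrier dihedral8. y \<otimes>\<^bsub>dihedral8\<^esub> x = \<one>\<^bsub>dihedral8\<^esub>" by blast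
qed (auto simp: dihedral8_simps)

lemma upper_central_dihedral8:
  "upper_central dihedral8 (Suc 0) = {0, 4}"
  "upper_central dihedral8 (Suc (Suc 0)) = carrier dihedral8"
proof -
  show one: "upper_central dihedral8 (Suc 0) = {0, 4}"
    unfolding set_eq_iff upper_central_Suc_iff[OF dihedral8_group] upper_central.simps(1)
    unfolding dihedral8_simps by auto
  \<comment> \<open>The commutator subgroup consists of the rotations 0 and 4, which are central.\<close>
  have "\<forall>x\<in>carrier dihedral8. \<forall>g\<in>carrier dihedral8. \<exists>n\<in>{0, 4}.
    x \<otimes>\<^bsub>dihedral8\<^esub> g = n \<otimes>\<^bsub>dihedral8\<^esub> (g \<otimes>\<^bsub>dihedral8\<^esub> x)"
    by code_simp
  then show "upper_central dihedral8 (Suc (Suc 0)) = carrier dihedral8"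
    unfolding set_eq_iff upper_central_Suc_iff[OF dihedral8_group] one by blast
qed

lemma dihedral8_nilpotent: "nilpotent_of_class dihedral8 2"
proof -
  have "upper_central dihedral8 0 \<subset> upper_central dihedral8 (Suc 0)"
    unfolding upper_central_dihedral8 upper_central.simps(1) dihedral8_simps by auto
  moreover have "upper_central dihedral8 (Suc 0) \<subset> upper_central dihedral8 (Suc (Suc 0))"
    unfolding upper_central_dihedral8 dihedral8_simps by auto
  ultimately have "\<forall>i<2. upper_central dihedral8 i \<subset> upper_central dihedral8 (Suc i)"
    unfolding numeral_2_eq_2 less_Suc_eq by blast
  moreover have "upper_central dihedral8 2 = carrier dihedral8"
    unfolding numeral_2_eq_2 by (rule upper_central_dihedral8)
  ultimately show ?thesis using dihedral8_group unfolding nilpotent_of_class_def by blast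
qed

theorem mainTheorem14:
  shows "\<exists>(G :: nat monoid) k \<phi>.
    finite (carrier G) \<and> nilpotent_of_class G k \<and> \<phi> \<in> iso G G \<and>
    reidemeister_number G \<phi> \<noteq>
      (\<Prod>i<k. subgroup_index (upper_central_factor G i)
                (twisted_class (upper_central_factor G i) (induced_map \<phi>)
                   \<one>\<^bsub>upper_central_factor G i\<^esub>))"
proof -
  have fin: "finite (carrier dihedral8)" by (simp add: dihedral8_simps)
  have iso: "id \<in> iso dihedral8 dihedral8" by (simp add: iso_def hom_def)
  have "reidemeister_number dihedral8 id < order dihedral8"
    by (rule reidemeister_number_id_less_order[OF dihedral8_group fin, of 1 2])
      (simp_all add: dihedral8_simps)
  then have "reidemeister_number dihedral8 id \<noteq>
      (\<Prod>i<2. subgroup_index (upper_central_factor dihedral8 i)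
        (twisted_class (upper_central_factor dihedral8 i) (induced_map id)
           \<one>\<^bsub>upper_central_factor dihedral8 i\<^esub>))"
    unfolding prod_subgroup_index_id[OF dihedral8_nilpotent] by simp
  with fin iso dihedral8_nilpotent show ?thesis by blast
qed

end
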